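(* Let $\lambda$ be a partition of $n$, let $\lambda'$ be the conjugate partition, and let $\alpha$ be a set partition of $[n]=\{1,\dots,n\}$ of type $\lambda'$. Let $T$ be an arbitrary collection of transpositions in $\mathfrak S_n$ that generates the Young subgroup $\mathfrak S_\alpha$, and put $$H_T=\sum_{\tau\in T}V_\lambda^{\tau}\subset V_\lambda .$$ Then the subspace $H_T$ depends only on $\alpha$ (not on the choice of the generating set $T$), and $\operatorname{codim} H_T=1$, i.e. $H_T$ is a hyperplane in $V_\lambda$.
   Context: $\mathfrak S_n$ is the symmetric group on $[n]=\{1,\dots,n\}$. For a partition $\lambda$ of $n$ (a Young diagram with $n$ cells), $\pi_\lambda$ is the irreducible complex representation of $\mathfrak S_n$ with diagram $\lambda$ (so $\pi_{(n)}$ is the trivial representation and $\pi_{(1^n)}$ is the sign representation), and $V_\lambda$ is its space. A set partition $\alpha$ of $[n]$ is of type $\mu$ ($\mu$ a partition of $n$) if the sizes of its blocks, in weakly decreasing order, form $\mu$. If $\alpha$ has blocks $A_1,\dots,A_k$, the Young subgroup $\mathfrak S_\alpha=\mathfrak S[A_1]\times\dots\times\mathfrak S[A_k]\subset\mathfrak S_n$ is the subgroup of permutations preserving each block. For $\sigma\in\mathfrak S_n$, $V_\lambda^\sigma=\{v\in V_\lambda:\pi_\lambda(\sigma)v=v\}$. A sum over an empty collection is the zero subspace. *)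

theory Defs
  imports Complex_Main "HOL-Library.Function_Algebras" "HOL-Library.Disjoint_Sets"
    "HOL-Library.Multiset" "HOL-Algebra.Sym_Groups"
begin

definition is_partition :: "nat \<Rightarrow> nat list \<Rightarrow> bool" where
  "is_partition n lam \<longleftrightarrow> sorted_wrt (\<ge>) lam \<and> 0 \<notin> set lam \<and> sum_list lam = n"

text \<open>Cells are pairs (row, column), both counted from 0.\<close>

definition diagram :: "nat list \<Rightarrow> (nat \<times> nat) set" where
  "diagram lam = {(i, j). i < length lam \<and> j < lam ! i}"

definition conj_partition :: "nat list \<Rightarrow> nat list" where
  "conj_partition lam = map (\<lambda>j. card {i. (i, j) \<in> diagram lam}) [0..<fold max lam 0]"

definition partition_type :: "'a set set \<Rightarrow> nat list" where
  "partition_type \<alpha> = rev (sorted_list_of_multiset (image_mset card (mset_set \<alpha>)))"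

definition young_subgroup :: "nat \<Rightarrow> nat set set \<Rightarrow> (nat \<Rightarrow> nat) set" where
  "young_subgroup n \<alpha> = {\<sigma> \<in> carrier (sym_group n). \<forall>A\<in>\<alpha>. \<sigma> ` A = A}"

definition transpositions :: "nat \<Rightarrow> (nat \<Rightarrow> nat) set" where
  "transpositions n =
     {Transposition.transpose a b | a b. a \<in> {1..n} \<and> b \<in> {1..n} \<and> a \<noteq> b}"


subsection \<open>Complex representations of the symmetric group\<close>

definition linear_on ::
  "(complex \<Rightarrow> 'v \<Rightarrow> 'v) \<Rightarrow> (complex \<Rightarrow> 'w \<Rightarrow> 'w) \<Rightarrow> 'v set
     \<Rightarrow> ('v::ab_group_add \<Rightarrow> 'w::ab_group_add) \<Rightarrow> bool" where
  "linear_on s s' V f \<longleftrightarrow>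
     (\<forall>x\<in>V. \<forall>y\<in>V. f (x + y) = f x + f y) \<and> (\<forall>c. \<forall>x\<in>V. f (s c x) = s' c (f x))"

text \<open>The space of the representation is a subspace \<open>V\<close> of an ambient complex vector space
  with scalar multiplication \<open>scale\<close>, since a type cannot depend on \<open>n\<close>.\<close>

locale sym_rep = vector_space scale
  for n :: nat and scale :: "complex \<Rightarrow> 'v::ab_group_add \<Rightarrow> 'v" (infixr \<open>*s\<close> 75)
    and V :: "'v set" and \<rho> :: "(nat \<Rightarrow> nat) \<Rightarrow> 'v \<Rightarrow> 'v" +
  assumes subspace_V: "subspace V"
    and rep_closed: "\<lbrakk>\<sigma> \<in> carrier (sym_group n); v \<in> V\<rbrakk> \<Longrightarrow> \<rho> \<sigma> v \<in> V"
    and rep_linear: "\<sigma> \<in> carrier (sym_group n) \<Longrightarrow> linear_on scale scale V (\<rho> \<sigma>)"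
    and rep_one: "v \<in> V \<Longrightarrow> \<rho> \<one>\<^bsub>sym_group n\<^esub> v = v"
    and rep_mult: "\<lbrakk>\<sigma> \<in> carrier (sym_group n); \<tau> \<in> carrier (sym_group n); v \<in> V\<rbrakk>
      \<Longrightarrow> \<rho> (\<sigma> \<otimes>\<^bsub>sym_group n\<^esub> \<tau>) v = \<rho> \<sigma> (\<rho> \<tau> v)"

definition rep_iso ::
  "nat \<Rightarrow> (complex \<Rightarrow> 'v \<Rightarrow> 'v) \<Rightarrow> 'v set \<Rightarrow> ((nat \<Rightarrow> nat) \<Rightarrow> 'v \<Rightarrow> 'v) \<Rightarrow>
     (complex \<Rightarrow> 'w \<Rightarrow> 'w) \<Rightarrow> 'w set \<Rightarrow> ((nat \<Rightarrow> nat) \<Rightarrow> 'w \<Rightarrow> 'w)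
     \<Rightarrow> ('v::ab_group_add \<Rightarrow> 'w::ab_group_add) \<Rightarrow> bool" where
  "rep_iso n s V \<rho> s' W \<rho>' f \<longleftrightarrow>
     bij_betw f V W \<and> linear_on s s' V f \<and>
     (\<forall>\<sigma>\<in>carrier (sym_group n). \<forall>v\<in>V. f (\<rho> \<sigma> v) = \<rho>' \<sigma> (f v))"


subsection \<open>Specht modules\<close>

definition is_tableau :: "nat \<Rightarrow> nat list \<Rightarrow> (nat \<times> nat \<Rightarrow> nat) \<Rightarrow> bool" where
  "is_tableau n lam t \<longleftrightarrow> bij_betw t (diagram lam) {1..n}"

definition columns :: "nat list \<Rightarrow> (nat \<times> nat \<Rightarrow> nat) \<Rightarrow> nat set set" where
  "columns lam t = (\<lambda>j. t ` {c \<in> diagram lam. snd c = j}) ` snd ` diagram lam"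

text \<open>A tabloid, that is, a tableau up to permutations within the rows, is encoded as the list of
  the sets of entries of its rows. Elements of the permutation module on tabloids are complex
  functions on such lists, vanishing away from tabloids.\<close>

definition tabloid :: "nat list \<Rightarrow> (nat \<times> nat \<Rightarrow> nat) \<Rightarrow> nat set list" where
  "tabloid lam t = map (\<lambda>i. t ` {c \<in> diagram lam. fst c = i}) [0..<length lam]"

definition tscale :: "complex \<Rightarrow> (nat set list \<Rightarrow> complex) \<Rightarrow> nat set list \<Rightarrow> complex" where
  "tscale c f = (\<lambda>D. c * f D)"

text \<open>Since \<open>\<sigma>\<close> sends the basis vector at \<open>D\<close> to the one at \<open>\<sigma> D\<close>, functions are acted on through
  the inverse.\<close>

definition tact :: "(nat \<Rightarrow> nat) \<Rightarrow> (nat set list \<Rightarrow> complex) \<Rightarrow> nat set list \<Rightarrow> complex" where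
  "tact \<sigma> f = (\<lambda>D. f (map ((`) (inv' \<sigma>)) D))"

definition polytabloid ::
  "nat \<Rightarrow> nat list \<Rightarrow> (nat \<times> nat \<Rightarrow> nat) \<Rightarrow> nat set list \<Rightarrow> complex" where
  "polytabloid n lam t =
     (\<Sum>\<sigma>\<in>young_subgroup n (columns lam t).
        tscale (of_int (sign \<sigma>)) (\<lambda>D. if D = tabloid lam (\<sigma> \<circ> t) then 1 else 0))"

definition specht :: "nat \<Rightarrow> nat list \<Rightarrow> (nat set list \<Rightarrow> complex) set" where
  "specht n lam = module.span tscale {polytabloid n lam t | t. is_tableau n lam t}"

text \<open>The irreducible representation with diagram \<open>lam\<close> is, up to isomorphism, the Specht module:
  trivial for one row, sign for one column.\<close>

definition irrep_with_diagram ::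
  "nat \<Rightarrow> nat list \<Rightarrow> (complex \<Rightarrow> 'v \<Rightarrow> 'v) \<Rightarrow> 'v::ab_group_add set
     \<Rightarrow> ((nat \<Rightarrow> nat) \<Rightarrow> 'v \<Rightarrow> 'v) \<Rightarrow> bool" where
  "irrep_with_diagram n lam scale V \<rho> \<longleftrightarrow>
     sym_rep n scale V \<rho> \<and> (\<exists>f. rep_iso n scale V \<rho> tscale (specht n lam) tact f)"


subsection \<open>Sums of spaces of invariants\<close>

definition fixed_space :: "'v set \<Rightarrow> ((nat \<Rightarrow> nat) \<Rightarrow> 'v \<Rightarrow> 'v) \<Rightarrow> (nat \<Rightarrow> nat) \<Rightarrow> 'v set" where
  "fixed_space V \<rho> \<sigma> = {v \<in> V. \<rho> \<sigma> v = v}"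

definition fixed_sum ::
  "'v::ab_group_add set \<Rightarrow> ((nat \<Rightarrow> nat) \<Rightarrow> 'v \<Rightarrow> 'v) \<Rightarrow> (nat \<Rightarrow> nat) set \<Rightarrow> 'v set" where
  "fixed_sum V \<rho> T = {\<Sum>\<tau>\<in>T. v \<tau> | v. \<forall>\<tau>\<in>T. v \<tau> \<in> fixed_space V \<rho> \<tau>}"


subsection \<open>The Specht module is a representation\<close>

lemma vector_space_tscale: "vector_space tscale"
  by unfold_locales (auto simp: tscale_def fun_eq_iff algebra_simps)

lemma tact_tabloid_basis:
  assumes "\<sigma> permutes {1..n}"
  shows "tact \<sigma> (\<lambda>D. if D = tabloid lam t then 1 else 0)
       = (\<lambda>D. if D = tabloid lam (\<sigma> \<circ> t) then 1 else 0)"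
proof -
  have b: "bij \<sigma>" using assms by (rule permutes_bij)
  have 1: "tabloid lam (\<sigma> \<circ> t) = map ((`) \<sigma>) (tabloid lam t)"
    by (simp add: tabloid_def image_comp)
  have i1: "inv' \<sigma> ` \<sigma> ` A = A" and i2: "\<sigma> ` inv' \<sigma> ` A = A" for A
    using assms by (simp_all add: image_image permutes_inverses)
  have "map ((`) (inv' \<sigma>)) D = tabloid lam t \<longleftrightarrow> D = tabloid lam (\<sigma> \<circ> t)" for D
  proof
    assume "map ((`) (inv' \<sigma>)) D = tabloid lam t"
    then have "map ((`) \<sigma>) (map ((`) (inv' \<sigma>)) D) = tabloid lam (\<sigma> \<circ> t)" using 1 by simp
    then show "D = tabloid lam (\<sigma> \<circ> t)" by (simp add: comp_def i2)
  next
    assume "D = tabloid lam (\<sigma> \<circ> t)"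
    then have "D = map ((`) \<sigma>) (tabloid lam t)" using 1 by simp
    then show "map ((`) (inv' \<sigma>)) D = tabloid lam t" by (simp add: comp_def i1)
  qed
  then show ?thesis by (simp add: tact_def fun_eq_iff)
qed

lemma tact_linear:
  "tact \<sigma> (f + g) = tact \<sigma> f + tact \<sigma> g" "tact \<sigma> (tscale c f) = tscale c (tact \<sigma> f)"
  "tact \<sigma> 0 = 0"
  by (auto simp: tact_def tscale_def fun_eq_iff)

lemma tact_sum: "tact \<sigma> (\<Sum>x\<in>A. f x) = (\<Sum>x\<in>A. tact \<sigma> (f x))"
  by (induction A rule: infinite_finite_induct)
    (simp_all only: sum.infinite sum.empty sum.insert tact_linear if_False not_False_eq_True)

lemma tact_polytabloid:
  assumes s: "\<sigma> permutes {1..n}"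
  shows "tact \<sigma> (polytabloid n lam t) = polytabloid n lam (\<sigma> \<circ> t)"
proof -
  let ?C = "young_subgroup n (columns lam t)"
  let ?C' = "young_subgroup n (columns lam (\<sigma> \<circ> t))"
  have cols: "columns lam (\<sigma> \<circ> t) = (`) \<sigma> ` columns lam t"
    by (auto simp: columns_def image_comp comp_def)
  have b: "bij \<sigma>" using s by (rule permutes_bij)
  have si: "inv' \<sigma> permutes {1..n}" using s by (rule permutes_inv)
  have ii: "inv' \<sigma> (\<sigma> x) = x" "\<sigma> (inv' \<sigma> x) = x" for x
    using s by (simp_all add: permutes_inverses)
  have i1: "inv' \<sigma> ` \<sigma> ` A = A" for A
    by (simp add: image_comp comp_def ii)
  have bij: "bij_betw (\<lambda>\<pi>. \<sigma> \<circ> \<pi> \<circ> inv' \<sigma>) ?C ?C'"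
  proof (rule bij_betw_byWitness[where f' = "\<lambda>\<pi>. inv' \<sigma> \<circ> \<pi> \<circ> \<sigma>"])
    show "(\<lambda>\<pi>. \<sigma> \<circ> \<pi> \<circ> inv' \<sigma>) ` ?C \<subseteq> ?C'"
    proof clarify
      fix \<pi> assume p: "\<pi> \<in> ?C"
      then have "\<sigma> \<circ> \<pi> \<circ> inv' \<sigma> permutes {1..n}"
        using s si by (auto simp: young_subgroup_def sym_group_def intro!: permutes_compose)
      moreover have "(\<sigma> \<circ> \<pi> \<circ> inv' \<sigma>) ` \<sigma> ` A = \<sigma> ` A" if "A \<in> columns lam t" for A
      proof -
        have "\<pi> ` A = A" using p that by (simp add: young_subgroup_def)
        then show ?thesis by (simp only: image_comp[symmetric] i1)
      qed
      ultimately show "\<sigma> \<circ> \<pi> \<circ> inv' \<sigma> \<in> ?C'"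
        by (auto simp: young_subgroup_def sym_group_def cols)
    qed
    show "(\<lambda>\<pi>. inv' \<sigma> \<circ> \<pi> \<circ> \<sigma>) ` ?C' \<subseteq> ?C"
    proof clarify
      fix \<pi> assume p: "\<pi> \<in> ?C'"
      then have "inv' \<sigma> \<circ> \<pi> \<circ> \<sigma> permutes {1..n}"
        using s si by (auto simp: young_subgroup_def sym_group_def intro!: permutes_compose)
      moreover have "(inv' \<sigma> \<circ> \<pi> \<circ> \<sigma>) ` A = A" if "A \<in> columns lam t" for A
      proof -
        have "\<pi> ` \<sigma> ` A = \<sigma> ` A" using p that by (auto simp: young_subgroup_def cols)
        then show ?thesis by (simp only: image_comp[symmetric] i1)
      qed
      ultimately show "inv' \<sigma> \<circ> \<pi> \<circ> \<sigma> \<in> ?C"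
        by (auto simp: young_subgroup_def sym_group_def)
    qed
  qed (auto simp: fun_eq_iff ii)
  have sg: "sign (\<sigma> \<circ> \<pi> \<circ> inv' \<sigma>) = sign \<pi>" if "\<pi> \<in> ?C" for \<pi>
  proof -
    have "permutation \<pi>" "permutation \<sigma>" "permutation (inv' \<sigma>)"
      using that s si by (auto simp: young_subgroup_def sym_group_def permutation_permutes)
    then show ?thesis
      by (simp add: sign_compose sign_inverse permutation_compose sign_idempotent)
  qed
  have "polytabloid n lam (\<sigma> \<circ> t) =
     (\<Sum>\<pi>\<in>?C. tscale (of_int (sign (\<sigma> \<circ> \<pi> \<circ> inv' \<sigma>)))
        (\<lambda>D. if D = tabloid lam ((\<sigma> \<circ> \<pi> \<circ> inv' \<sigma>) \<circ> (\<sigma> \<circ> t)) then 1 else 0))"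
    unfolding polytabloid_def by (rule sum.reindex_bij_betw[OF bij, symmetric])
  also have "\<dots> = (\<Sum>\<pi>\<in>?C. tscale (of_int (sign \<pi>))
        (\<lambda>D. if D = tabloid lam (\<sigma> \<circ> (\<pi> \<circ> t)) then 1 else 0))"
  proof (rule sum.cong[OF refl])
    fix \<pi> assume p: "\<pi> \<in> ?C"
    have "(\<sigma> \<circ> \<pi> \<circ> inv' \<sigma>) \<circ> (\<sigma> \<circ> t) = \<sigma> \<circ> (\<pi> \<circ> t)" by (simp add: fun_eq_iff ii)
    then show "tscale (of_int (sign (\<sigma> \<circ> \<pi> \<circ> inv' \<sigma>)))
        (\<lambda>D. if D = tabloid lam ((\<sigma> \<circ> \<pi> \<circ> inv' \<sigma>) \<circ> (\<sigma> \<circ> t)) then 1 else 0)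
      = tscale (of_int (sign \<pi>)) (\<lambda>D. if D = tabloid lam (\<sigma> \<circ> (\<pi> \<circ> t)) then 1 else 0)"
      by (simp add: sg[OF p])
  qed
  also have "\<dots> = tact \<sigma> (polytabloid n lam t)"
    by (simp add: polytabloid_def tact_sum tact_linear tact_tabloid_basis[OF s])
  finally show ?thesis ..
qed

lemma sym_rep_specht: "sym_rep n tscale (specht n lam) tact"
proof -
  interpret vector_space tscale by (rule vector_space_tscale)
  show ?thesis
  proof
    show "subspace (specht n lam)" by (simp add: specht_def)
  next
    fix \<sigma> v assume s: "\<sigma> \<in> carrier (sym_group n)" and v: "v \<in> specht n lam"
    have p: "\<sigma> permutes {1..n}" using s by (simp add: sym_group_def)
    show "tact \<sigma> v \<in> specht n lam"
      using v unfolding specht_def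
    proof (induction rule: span_induct_alt)
      case base
      then show ?case by (simp only: tact_linear span_zero)
    next
      case (step c x y)
      then obtain t where t: "x = polytabloid n lam t" "is_tableau n lam t" by auto
      have "is_tableau n lam (\<sigma> \<circ> t)"
        using t(2) permutes_imp_bij[OF p] unfolding is_tableau_def by (rule bij_betw_trans)
      then have "tact \<sigma> x \<in> {polytabloid n lam t | t. is_tableau n lam t}"
        using t(1) tact_polytabloid[OF p] by blast
      then show ?case
        unfolding tact_linear by (intro span_add span_scale step.IH) (rule span_base)
    qed
  next
    fix \<sigma> \<tau> and v :: "nat set list \<Rightarrow> complex"
    assume s: "\<sigma> \<in> carrier (sym_group n)" "\<tau> \<in> carrier (sym_group n)"
    then have "inv' (\<sigma> \<circ> \<tau>) = inv' \<tau> \<circ> inv' \<sigma>"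
      by (intro o_inv_distrib) (auto simp: sym_group_def permutes_bij)
    then show "tact (\<sigma> \<otimes>\<^bsub>sym_group n\<^esub> \<tau>) v = tact \<sigma> (tact \<tau> v)"
      by (simp add: tact_def sym_group_def comp_def image_comp)
  qed (auto simp: linear_on_def tact_def tscale_def sym_group_def)
qed

lemma irrep_with_diagram_specht: "irrep_with_diagram n lam tscale (specht n lam) tact"
  unfolding irrep_with_diagram_def rep_iso_def
  by (intro conjI sym_rep_specht exI[of _ id]) (auto simp: linear_on_def)

end

theory Submission
  imports Defs
begin

text \<open>Let \<open>G\<close> be the Young subgroup of \<open>\<alpha>\<close> and \<open>a = \<Sum>\<^sub>g sgn(g) g\<close> its alternating element. Vectors fixed by
  a transposition in \<open>G\<close> are killed by \<open>a\<close>. Conversely \<open>v - sgn(g) g v\<close> lies in \<open>H\<^sub>T\<close> for all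
  \<open>g \<in> G\<close>, by induction on a word for \<open>g\<close> in the elements of \<open>T\<close>; summing over \<open>g\<close> puts
  \<open>|G| v - a v\<close> into \<open>H\<^sub>T\<close>. Hence \<open>H\<^sub>T\<close> is the kernel of \<open>a\<close> on \<open>V\<close>, which does not involve \<open>T\<close>.

  Since \<open>\<alpha>\<close> has the conjugate type, it is the set of columns of a tableau \<open>t\<close>. A vector of the
  Specht module on which the column group of \<open>t\<close> acts by the sign is determined by its coefficient
  at the tabloid of \<open>t\<close>, so it is a multiple of the polytabloid \<open>e\<^sub>t\<close>; and \<open>a e\<^sub>t = |G| e\<^sub>t \<noteq> 0\<close>.
  Thus \<open>a\<close> has rank one.\<close>

subsection \<open>The alternating element of a Young subgroup\<close>

lemma young_subgroup_iff:
  "\<sigma> \<in> young_subgroup n \<alpha> \<longleftrightarrow> \<sigma> permutes {1..n} \<and> (\<forall>A\<in>\<alpha>. \<sigma> ` A = A)"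
  by (simp add: young_subgroup_def sym_group_def)

lemma young_subgroup_id: "id \<in> young_subgroup n \<alpha>"
  by (simp add: young_subgroup_iff permutes_id)

lemma young_subgroup_comp:
  "\<lbrakk>\<sigma> \<in> young_subgroup n \<alpha>; \<tau> \<in> young_subgroup n \<alpha>\<rbrakk> \<Longrightarrow> \<sigma> \<circ> \<tau> \<in> young_subgroup n \<alpha>"
  by (metis image_comp permutes_compose young_subgroup_iff)

lemma young_subgroup_inv:
  assumes "\<sigma> \<in> young_subgroup n \<alpha>"
  shows "inv' \<sigma> \<in> young_subgroup n \<alpha>"
proof -
  have p: "\<sigma> permutes {1..n}" using assms by (simp add: young_subgroup_iff)
  have "inv' \<sigma> ` A = A" if "A \<in> \<alpha>" for A
    using assms that permutes_inj[OF p] by (metis image_inv_f_f young_subgroup_iff)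
  then show ?thesis using permutes_inv[OF p] by (simp add: young_subgroup_iff)
qed

lemma finite_young_subgroup: "finite (young_subgroup n \<alpha>)"
  by (rule finite_subset[OF _ finite_permutations[of "{1..n}"]]) (auto simp: young_subgroup_iff)

lemma young_subgroup_sign_comp:
  "\<lbrakk>\<sigma> \<in> young_subgroup n \<alpha>; \<tau> \<in> young_subgroup n \<alpha>\<rbrakk> \<Longrightarrow> sign (\<sigma> \<circ> \<tau>) = sign \<sigma> * sign \<tau>"
  by (metis finite_atLeastAtMost permutation_permutes sign_compose young_subgroup_iff)

lemma bij_young_subgroup_comp_left:
  assumes "g \<in> young_subgroup n \<alpha>"
  shows "bij_betw ((\<circ>) g) (young_subgroup n \<alpha>) (young_subgroup n \<alpha>)"
proof -
  have "g permutes {1..n}" using assms by (simp add: young_subgroup_iff)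
  note i = permutes_inv_o[OF this]
  show ?thesis
    by (rule bij_betw_byWitness[where f' = "(\<circ>) (inv' g)"])
      (auto simp: o_assoc i intro: young_subgroup_comp young_subgroup_inv assms)
qed

lemma bij_young_subgroup_comp_right:
  assumes "g \<in> young_subgroup n \<alpha>"
  shows "bij_betw (\<lambda>h. h \<circ> g) (young_subgroup n \<alpha>) (young_subgroup n \<alpha>)"
proof -
  have "g permutes {1..n}" using assms by (simp add: young_subgroup_iff)
  note i = permutes_inv_o[OF this]
  show ?thesis
    by (rule bij_betw_byWitness[where f' = "\<lambda>h. h \<circ> inv' g"])
      (auto simp: o_assoc[symmetric] i intro: young_subgroup_comp young_subgroup_inv assms)
qed

lemma sign_times_sign: "of_int (sign g) * of_int (sign g) = (1 :: complex)"
  by (metis of_int_1 of_int_mult sign_idempotent)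

section \<open>Maps that are linear on a subspace only\<close>

lemma linear_on_0:
  assumes "linear_on s s' V f" "0 \<in> V"
  shows "f 0 = 0"
proof -
  have "f (0 + 0) = f 0 + f 0" using assms unfolding linear_on_def by blast
  then show ?thesis by simp
qed

lemma linear_on_sum:
  assumes "linear_on s s' V f" "module.subspace s V" "module s" "\<And>i. i \<in> I \<Longrightarrow> v i \<in> V"
  shows "f (\<Sum>i\<in>I. v i) = (\<Sum>i\<in>I. f (v i))"
proof -
  interpret module s by fact
  show ?thesis
    using assms(4)
  proof (induction I rule: infinite_finite_induct)
    case (insert i I)
    then have "(\<Sum>i\<in>I. v i) \<in> V" using assms(2) by (intro subspace_sum) auto
    then show ?case using insert assms(1) by (simp add: linear_on_def)
  qed (use linear_on_0[OF assms(1) subspace_0[OF assms(2)]] in simp_all)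
qed

text \<open>The unnormalised projection onto the vectors on which the Young subgroup acts by the sign.\<close>

definition alternator ::
  "nat \<Rightarrow> (complex \<Rightarrow> 'v \<Rightarrow> 'v) \<Rightarrow> ((nat \<Rightarrow> nat) \<Rightarrow> 'v \<Rightarrow> 'v) \<Rightarrow> nat set set
     \<Rightarrow> 'v::ab_group_add \<Rightarrow> 'v" where
  "alternator n s \<rho> \<alpha> v = (\<Sum>g\<in>young_subgroup n \<alpha>. s (of_int (sign g)) (\<rho> g v))"

section \<open>The alternating element acting on a representation\<close>

context sym_rep
begin

lemma young_rep_closed: "\<lbrakk>g \<in> young_subgroup n \<alpha>; v \<in> V\<rbrakk> \<Longrightarrow> \<rho> g v \<in> V"
  by (rule rep_closed) (simp_all add: young_subgroup_def)

lemma young_rep_linear: "g \<in> young_subgroup n \<alpha> \<Longrightarrow> linear_on scale scale V (\<rho> g)"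
  by (rule rep_linear) (simp_all add: young_subgroup_def)

lemma young_rep_comp:
  "\<lbrakk>g \<in> young_subgroup n \<alpha>; h \<in> young_subgroup n \<alpha>; v \<in> V\<rbrakk> \<Longrightarrow> \<rho> (g \<circ> h) v = \<rho> g (\<rho> h v)"
  using rep_mult[of g h v] by (simp add: young_subgroup_def sym_group_def)

lemma rep_id: "v \<in> V \<Longrightarrow> \<rho> id v = v"
  using rep_one by (simp add: sym_group_def)

lemma young_rep_scale: "\<lbrakk>g \<in> young_subgroup n \<alpha>; v \<in> V\<rbrakk> \<Longrightarrow> \<rho> g (c *s v) = c *s \<rho> g v"
  using young_rep_linear unfolding linear_on_def by blast

lemma young_rep_add: "\<lbrakk>g \<in> young_subgroup n \<alpha>; v \<in> V; w \<in> V\<rbrakk> \<Longrightarrow> \<rho> g (v + w) = \<rho> g v + \<rho> g w"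
  using young_rep_linear unfolding linear_on_def by blast

lemma alternator_closed: "v \<in> V \<Longrightarrow> alternator n scale \<rho> \<alpha> v \<in> V"
  unfolding alternator_def
  by (intro subspace_sum subspace_scale subspace_V young_rep_closed)

lemma alternator_linear: "linear_on scale scale V (alternator n scale \<rho> \<alpha>)"
  unfolding linear_on_def
proof (intro conjI ballI allI)
  fix x y assume "x \<in> V" "y \<in> V"
  then show "alternator n scale \<rho> \<alpha> (x + y)
      = alternator n scale \<rho> \<alpha> x + alternator n scale \<rho> \<alpha> y"
    by (simp add: alternator_def young_rep_add scale_right_distrib sum.distrib)
next
  fix c x assume "x \<in> V"
  then show "alternator n scale \<rho> \<alpha> (c *s x) = c *s alternator n scale \<rho> \<alpha> x"
    by (simp add: alternator_def young_rep_scale scale_sum_right mult.commute)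
qed

text \<open>Left multiplication by \<open>g\<close> permutes the summands, and
  \<open>sign g * sign (g \<circ> h) = sign h\<close> because signs square to one.\<close>

lemma rep_alternator:
  assumes g: "g \<in> young_subgroup n \<alpha>" and v: "v \<in> V"
  shows "\<rho> g (alternator n scale \<rho> \<alpha> v) = of_int (sign g) *s alternator n scale \<rho> \<alpha> v"
proof -
  have "of_int (sign g) *s alternator n scale \<rho> \<alpha> v
      = of_int (sign g) *s (\<Sum>h\<in>young_subgroup n \<alpha>. of_int (sign (g \<circ> h)) *s \<rho> (g \<circ> h) v)"
    unfolding alternator_def
    by (subst sum.reindex_bij_betw[OF bij_young_subgroup_comp_left[OF g], symmetric]) (rule refl)
  also have "\<dots> = (\<Sum>h\<in>young_subgroup n \<alpha>. of_int (sign h) *s \<rho> g (\<rho> h v))"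
    unfolding scale_sum_right
    by (intro sum.cong refl)
      (simp only: scale_scale young_subgroup_sign_comp[OF g] young_rep_comp[OF g _ v] of_int_mult
        mult.assoc[symmetric] sign_times_sign mult_1)
  also have "\<dots> = \<rho> g (alternator n scale \<rho> \<alpha> v)"
    unfolding alternator_def
    by (subst linear_on_sum[OF young_rep_linear[OF g] subspace_V])
      (auto simp: young_rep_scale[OF g] v young_rep_closed intro!: subspace_scale subspace_V, unfold_locales)
  finally show ?thesis ..
qed

text \<open>The same reindexing, now by right multiplication with \<open>g\<close>.\<close>

lemma alternator_rep:
  assumes g: "g \<in> young_subgroup n \<alpha>" and v: "v \<in> V"
  shows "alternator n scale \<rho> \<alpha> (\<rho> g v) = of_int (sign g) *s alternator n scale \<rho> \<alpha> v"
proof -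
  have "of_int (sign g) *s alternator n scale \<rho> \<alpha> v
      = of_int (sign g) *s (\<Sum>h\<in>young_subgroup n \<alpha>. of_int (sign (h \<circ> g)) *s \<rho> (h \<circ> g) v)"
    unfolding alternator_def
    by (subst sum.reindex_bij_betw[OF bij_young_subgroup_comp_right[OF g], symmetric]) (rule refl)
  also have "\<dots> = (\<Sum>h\<in>young_subgroup n \<alpha>. of_int (sign h) *s \<rho> h (\<rho> g v))"
    unfolding scale_sum_right
    by (intro sum.cong refl)
      (simp only: scale_scale young_subgroup_sign_comp[OF _ g] young_rep_comp[OF _ g v] of_int_mult
        mult.left_commute[of "of_int (sign g)"] sign_times_sign mult_1_right)
  finally show ?thesis by (simp add: alternator_def)
qed

text \<open>Acting by \<open>g\<close> leaves \<open>v\<close> alone but negates its alternator, so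
  twice the alternator vanishes, and 2 is invertible in the complex numbers.\<close>

lemma alternator_fixed:
  assumes g: "g \<in> young_subgroup n \<alpha>" and v: "v \<in> fixed_space V \<rho> g" and s: "sign g = -1"
  shows "alternator n scale \<rho> \<alpha> v = 0"
proof -
  have "alternator n scale \<rho> \<alpha> v = - alternator n scale \<rho> \<alpha> v"
    using alternator_rep[OF g, of v] v s by (simp add: fixed_space_def)
  then have "(1 + 1) *s alternator n scale \<rho> \<alpha> v = 0"
    by (simp only: scale_left_distrib scale_one eq_neg_iff_add_eq_0)
  then show ?thesis by simp
qed

section \<open>Sums of fixed spaces as kernels of the alternating element\<close>

lemma subspace_fixed_space:
  assumes "g \<in> young_subgroup n \<alpha>"
  shows "subspace (fixed_space V \<rho> g)"
  using subspace_V linear_on_0[OF young_rep_linear[OF assms] subspace_0[OF subspace_V]]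
  by (auto simp: subspace_def fixed_space_def young_rep_add[OF assms] young_rep_scale[OF assms])

lemma subspace_fixed_sum:
  assumes "T \<subseteq> young_subgroup n \<alpha>"
  shows "subspace (fixed_sum V \<rho> T)"
proof (rule subspaceI)
  have T: "subspace (fixed_space V \<rho> \<tau>)" if "\<tau> \<in> T" for \<tau>
    using that assms by (blast intro: subspace_fixed_space)
  show "0 \<in> fixed_sum V \<rho> T"
    unfolding fixed_sum_def
    by (rule CollectI, rule exI[of _ "\<lambda>_. 0"]) (simp add: subspace_0[OF T])
  show "x + y \<in> fixed_sum V \<rho> T" if xy: "x \<in> fixed_sum V \<rho> T" "y \<in> fixed_sum V \<rho> T" for x y
  proof -
    obtain v w where "x = (\<Sum>\<tau>\<in>T. v \<tau>)" "y = (\<Sum>\<tau>\<in>T. w \<tau>)"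
        "\<forall>\<tau>\<in>T. v \<tau> \<in> fixed_space V \<rho> \<tau>" "\<forall>\<tau>\<in>T. w \<tau> \<in> fixed_space V \<rho> \<tau>"
      using xy by (auto simp: fixed_sum_def)
    then show ?thesis
      unfolding fixed_sum_def
      by (intro CollectI exI[of _ "\<lambda>\<tau>. v \<tau> + w \<tau>"]) (auto simp: sum.distrib subspace_add[OF T])
  qed
  show "c *s x \<in> fixed_sum V \<rho> T" if x: "x \<in> fixed_sum V \<rho> T" for c x
  proof -
    obtain v where "x = (\<Sum>\<tau>\<in>T. v \<tau>)" "\<forall>\<tau>\<in>T. v \<tau> \<in> fixed_space V \<rho> \<tau>"
      using x by (auto simp: fixed_sum_def)
    then show ?thesis
      unfolding fixed_sum_def
      by (intro CollectI exI[of _ "\<lambda>\<tau>. c *s v \<tau>"]) (auto simp: scale_sum_right subspace_scale[OF T])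
  qed
qed

lemma fixed_sum_base:
  assumes "T \<subseteq> young_subgroup n \<alpha>" "\<tau> \<in> T" "v \<in> fixed_space V \<rho> \<tau>"
  shows "v \<in> fixed_sum V \<rho> T"
  unfolding fixed_sum_def
proof (intro CollectI exI[of _ "\<lambda>\<sigma>. if \<sigma> = \<tau> then v else 0"] conjI ballI)
  \<comment> \<open>A \<open>sum\<close> over an infinite index set is 0 by convention, so the
    family supported at \<open>\<tau>\<close> adds up to \<open>v\<close> only because
    \<open>T\<close> lies in a finite group.\<close>
  have "finite T" using assms(1) finite_young_subgroup finite_subset by blast
  then show "v = (\<Sum>\<sigma>\<in>T. if \<sigma> = \<tau> then v else 0)" using assms(2) by simp
  show "(if \<sigma> = \<tau> then v else 0) \<in> fixed_space V \<rho> \<sigma>" if "\<sigma> \<in> T" for \<sigma>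
    using that assms by (auto intro: subspace_0 subspace_fixed_space)
qed

text \<open>With \<open>w = sgn(h) h v\<close>, the difference for \<open>g \<circ> h\<close>
  telescopes into \<open>(v - w) + (w - sgn(g) g w)\<close>. The induction therefore needs the claim
  for all vectors at once: it is used for \<open>h\<close> at \<open>v\<close> and for
  \<open>g\<close> at \<open>w\<close>.\<close>

lemma diff_rep_in_fixed_sum:
  assumes T: "T \<subseteq> transpositions n" and G: "generate (sym_group n) T = young_subgroup n \<alpha>"
    and "g \<in> young_subgroup n \<alpha>" and "v \<in> V"
  shows "v - of_int (sign g) *s \<rho> g v \<in> fixed_sum V \<rho> T"
proof -
  have TG: "T \<subseteq> young_subgroup n \<alpha>"
    unfolding G[symmetric] by (rule subsetI, rule generate.incl)
  note H = subspace_fixed_sum[OF TG]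
  have trans: "v - of_int (sign h) *s \<rho> h v \<in> fixed_sum V \<rho> T" if h: "h \<in> T" and v: "v \<in> V" for h v
  proof -
    obtain a b where ab: "a \<noteq> b" "h = Transposition.transpose a b"
      using h T by (auto simp: transpositions_def)
    have hG: "h \<in> young_subgroup n \<alpha>" using h TG by blast
    have hh: "h \<circ> h = id" using ab(2) by simp
    have sg: "sign h = -1" using ab by (simp add: sign_swap_id)
    have hv: "\<rho> h v \<in> V" by (rule young_rep_closed[OF hG v])
    \<comment> \<open>Since \<open>h \<circ> h = id\<close>, the transposition swaps the two
      summands of \<open>v + h v\<close>. As its sign is -1, this sum is exactly the difference in
      question.\<close>
    have "\<rho> h (v + \<rho> h v) = \<rho> h v + \<rho> (h \<circ> h) v"
      by (simp only: young_rep_add[OF hG v hv] young_rep_comp[OF hG hG v])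
    then have "\<rho> h (v + \<rho> h v) = v + \<rho> h v"
      unfolding hh rep_id[OF v] by (simp only: add.commute)
    then have "v + \<rho> h v \<in> fixed_space V \<rho> h"
      using subspace_add[OF subspace_V v hv] by (simp add: fixed_space_def)
    then show ?thesis using fixed_sum_base[OF TG h] sg by simp
  qed
  have "g \<in> generate (sym_group n) T" using assms by simp
  then show ?thesis using \<open>v \<in> V\<close>
  proof (induction g arbitrary: v rule: generate.induct)
    case one
    then show ?case using subspace_0[OF H]
      by (simp only: sym_group_one rep_id sign_id of_int_1 scale_one diff_self)
  next
    case (incl h)
    then show ?case by (rule trans)
  next
    case (inv h)
    \<comment> \<open>\<open>generate\<close> also admits inverses of generators; a transposition is
      its own inverse, which reduces this case to the previous one.\<close>
    obtain a b where ab: "h = Transposition.transpose a b"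
      using inv(1) T by (auto simp: transpositions_def)
    have hG: "h \<in> carrier (sym_group n)"
      using inv(1) TG by (auto simp: young_subgroup_def)
    have hh: "h \<circ> h = id" using ab by simp
    have "inv\<^bsub>sym_group n\<^esub> h = h"
      by (rule group.inv_equality[OF sym_group_is_group _ hG hG]) (simp add: sym_group_def hh)
    then show ?case using trans[OF inv] by simp
  next
    case (eng g h)
    then have g: "g \<in> young_subgroup n \<alpha>" and h: "h \<in> young_subgroup n \<alpha>" using G by simp_all
    let ?w = "of_int (sign h) *s \<rho> h v"
    note hv = young_rep_closed[OF h eng.prems]
    have w: "?w \<in> V" by (rule subspace_scale[OF subspace_V hv])
    have "\<rho> g ?w = of_int (sign h) *s \<rho> (g \<circ> h) v"
      by (simp only: young_rep_scale[OF g hv] young_rep_comp[OF g h eng.prems])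
    then have "(v - ?w) + (?w - of_int (sign g) *s \<rho> g ?w)
        = v - of_int (sign (g \<circ> h)) *s \<rho> (g \<circ> h) v"
      by (simp add: young_subgroup_sign_comp[OF g h])
    then show ?case
      using subspace_add[OF H eng.IH(2)[OF eng.prems] eng.IH(1)[OF w]]
      by (simp only: sym_group_mult)
  qed
qed

lemma card_scale_minus_alternator:
  assumes T: "T \<subseteq> transpositions n" and G: "generate (sym_group n) T = young_subgroup n \<alpha>"
    and "v \<in> V"
  shows "of_nat (card (young_subgroup n \<alpha>)) *s v - alternator n scale \<rho> \<alpha> v \<in> fixed_sum V \<rho> T"
proof -
  have TG: "T \<subseteq> young_subgroup n \<alpha>"
    unfolding G[symmetric] by (rule subsetI, rule generate.incl)
  have "(\<Sum>g\<in>young_subgroup n \<alpha>. v - of_int (sign g) *s \<rho> g v) \<in> fixed_sum V \<rho> T"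
    by (intro subspace_sum subspace_fixed_sum[OF TG] diff_rep_in_fixed_sum[OF T G] \<open>v \<in> V\<close>)
  then show ?thesis by (simp add: sum_subtractf alternator_def sum_constant_scale)
qed

lemma fixed_sum_eq_kernel:
  assumes T: "T \<subseteq> transpositions n" and G: "generate (sym_group n) T = young_subgroup n \<alpha>"
  shows "fixed_sum V \<rho> T = {v \<in> V. alternator n scale \<rho> \<alpha> v = 0}"
proof (intro equalityI subsetI)
  have TG: "T \<subseteq> young_subgroup n \<alpha>"
    unfolding G[symmetric] by (rule subsetI, rule generate.incl)
  {
    fix x assume "x \<in> fixed_sum V \<rho> T"
    then obtain v where x: "x = (\<Sum>\<tau>\<in>T. v \<tau>)" and v: "\<forall>\<tau>\<in>T. v \<tau> \<in> fixed_space V \<rho> \<tau>"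
      by (auto simp: fixed_sum_def)
    then have vV: "v \<tau> \<in> V" if "\<tau> \<in> T" for \<tau> using that by (auto simp: fixed_space_def)
    then have "x \<in> V" unfolding x by (intro subspace_sum subspace_V)
    moreover have "alternator n scale \<rho> \<alpha> (v \<tau>) = 0" if "\<tau> \<in> T" for \<tau>
    proof (rule alternator_fixed)
      show "sign \<tau> = -1" using that T by (auto simp: transpositions_def sign_swap_id)
    qed (use that v TG in auto)
    then have "alternator n scale \<rho> \<alpha> x = 0"
      unfolding x using linear_on_sum[OF alternator_linear subspace_V module_axioms vV, of T "\<lambda>t. t"]
      by simp
    ultimately show "x \<in> {v \<in> V. alternator n scale \<rho> \<alpha> v = 0}" by simp
  next
    fix v assume "v \<in> {v \<in> V. alternator n scale \<rho> \<alpha> v = 0}"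
    then have "of_nat (card (young_subgroup n \<alpha>)) *s v \<in> fixed_sum V \<rho> T"
      using card_scale_minus_alternator[OF assms, of v] by simp
    \<comment> \<open>On the kernel only the term \<open>|G| v\<close> is left, and division by the
      group order recovers \<open>v\<close>.\<close>
    then have "inverse (of_nat (card (young_subgroup n \<alpha>)))
        *s (of_nat (card (young_subgroup n \<alpha>)) *s v) \<in> fixed_sum V \<rho> T"
      by (rule subspace_scale[OF subspace_fixed_sum[OF TG]])
    moreover have "card (young_subgroup n \<alpha>) \<noteq> 0"
      using young_subgroup_id finite_young_subgroup by (metis card_eq_0_iff empty_iff)
    ultimately show "v \<in> fixed_sum V \<rho> T" by simp
  }
qed

end

subsection \<open>Alternating vectors of the Specht module\<close>

lemma finite_diagram: "finite (diagram lam)"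
proof -
  have "diagram lam = (SIGMA i:{..<length lam}. {..<lam ! i})" by (auto simp: diagram_def)
  then show ?thesis by simp
qed

lemma diagram_down_closed:
  assumes "is_partition n lam" "(i, j) \<in> diagram lam" "i' < i"
  shows "(i', j) \<in> diagram lam"
  using assms sorted_wrt_nth_less[of "(\<ge>)" lam i' i]
  by (auto simp: is_partition_def diagram_def)

lemma down_closed_eq_lessThan:
  fixes X :: "nat set"
  assumes "finite X" "\<And>i i'. \<lbrakk>i \<in> X; i' < i\<rbrakk> \<Longrightarrow> i' \<in> X"
  shows "X = {..<card X}"
proof (cases "X = {}")
  case False
  have "X = {..<Suc (Max X)}"
    using assms Max_ge[OF assms(1)] Max_in[OF assms(1) False]
    by (auto simp: less_Suc_eq_le le_less)
  then show ?thesis by (metis card_lessThan)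
qed simp

text \<open>Row lengths decrease weakly, so with a cell all cells above it belong to the
  diagram.\<close>

lemma column_eq_lessThan:
  assumes "is_partition n lam"
  shows "{i. (i, j) \<in> diagram lam} = {..<card {i. (i, j) \<in> diagram lam}}"
proof (rule down_closed_eq_lessThan)
  have "{i. (i, j) \<in> diagram lam} \<subseteq> fst ` diagram lam" by force
  then show "finite {i. (i, j) \<in> diagram lam}" using finite_diagram finite_surj by blast
qed (use diagram_down_closed[OF assms] in blast)

text \<open>Remove the largest element: it is at least \<open>card X - 1\<close>, and induction
  handles the rest. Equality of the sums forces equality at both places.\<close>

lemma sum_lessThan_card_le:
  fixes X :: "nat set"
  assumes "finite X"
  shows "\<Sum>{..<card X} \<le> \<Sum>X"
    and "\<Sum>{..<card X} = \<Sum>X \<Longrightarrow> X = {..<card X}"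
proof -
  have "\<Sum>{..<card X} \<le> \<Sum>X \<and> (\<Sum>{..<card X} = \<Sum>X \<longrightarrow> X = {..<card X})"
    using assms
  proof (induction "card X" arbitrary: X)
    case (Suc c)
    define m where "m = Max X"
    have ne: "X \<noteq> {}" using Suc by auto
    have m: "m \<in> X" unfolding m_def using Suc ne by (intro Max_in)
    have "X \<subseteq> {..m}" using Suc by (auto simp: m_def)
    then have "card X \<le> Suc m" by (metis card_atMost card_mono finite_atMost)
    then have cm: "c \<le> m" using Suc by simp
    have card: "card (X - {m}) = c" using Suc m by (metis card_Diff_singleton diff_Suc_1)
    have s: "\<Sum>X = m + \<Sum>(X - {m})" using sum.remove[of X m "\<lambda>x. x"] Suc m by simp
    have IH: "\<Sum>{..<c} \<le> \<Sum>(X - {m})" "\<Sum>{..<c} = \<Sum>(X - {m}) \<longrightarrow> X - {m} = {..<c}"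
      using Suc.hyps(1)[of "X - {m}"] Suc.prems card by simp_all
    have c: "\<Sum>{..<card X} = c + \<Sum>{..<c}" using Suc(2)[symmetric] by simp
    show ?case
    proof (intro conjI impI)
      show "\<Sum>{..<card X} \<le> \<Sum>X" using s c IH(1) cm by linarith
      assume "\<Sum>{..<card X} = \<Sum>X"
      then have "m = c" "\<Sum>{..<c} = \<Sum>(X - {m})" using s c IH(1) cm by linarith+
      then have "X - {c} = {..<c}" "c \<in> X" using IH(2) m by auto
      then have "X = {..<Suc c}" by (auto simp: lessThan_Suc)
      then show "X = {..<card X}" using Suc(2) by simp
    qed
  qed simp
  then show "\<Sum>{..<card X} \<le> \<Sum>X" "\<Sum>{..<card X} = \<Sum>X \<Longrightarrow> X = {..<card X}" by auto
qed

section \<open>Comparing two tableaux by rows and columns\<close>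

lemma tableau_inj: "is_tableau n lam t \<Longrightarrow> inj_on t (diagram lam)"
  and tableau_image: "is_tableau n lam t \<Longrightarrow> t ` diagram lam = {1..n}"
  by (simp_all add: is_tableau_def bij_betw_def)

lemma tabloid_comp: "tabloid lam (\<sigma> \<circ> t) = map ((`) \<sigma>) (tabloid lam t)"
  by (simp add: tabloid_def image_comp)

lemma tabloid_eq_iff:
  "tabloid lam s = tabloid lam t \<longleftrightarrow>
     (\<forall>i<length lam. s ` {c \<in> diagram lam. fst c = i} = t ` {c \<in> diagram lam. fst c = i})"
  by (simp add: tabloid_def Ball_def)

text \<open>Taken with \<open>k = fst\<close> or \<open>k = snd\<close>, this locates the row or
  column in which an entry of a tableau stands.\<close>

lemma mem_image_class_iff:
  assumes "inj_on t D" "c \<in> D"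
  shows "t c \<in> t ` {d \<in> D. k d = i} \<longleftrightarrow> k c = i"
  using assms by (auto dest: inj_onD)

text \<open>The entries of every column of \<open>t\<close> lie in distinct rows of \<open>s\<close>, so the row indices in a
  column of length \<open>k\<close> sum to at least \<open>0 + \<dots> + (k - 1)\<close>. The total over all columns is the same as
  for \<open>t\<close> itself, which forces the row indices to be exactly \<open>0, \<dots>, k - 1\<close>.\<close>

lemma exists_column_permutation:
  assumes lam: "is_partition n lam" and t: "is_tableau n lam t" and s: "is_tableau n lam s"
    and distinct: "\<And>c c' d d'. \<lbrakk>c \<in> diagram lam; c' \<in> diagram lam; d \<in> diagram lam; d' \<in> diagram lam;
        snd c = snd c'; t c = s d; t c' = s d'; fst d = fst d'\<rbrakk> \<Longrightarrow> c = c'"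
  shows "\<exists>p\<in>young_subgroup n (columns lam t). tabloid lam (p \<circ> s) = tabloid lam t"
proof -
  let ?D = "diagram lam"
  note ti = tableau_inj[OF t] and tim = tableau_image[OF t]
  note si = tableau_inj[OF s] and sim = tableau_image[OF s]
  \<comment> \<open>\<open>r c\<close> is the row of \<open>s\<close> that holds the entry which
    \<open>t\<close> has in the cell \<open>c\<close>.\<close>
  define r where "r c = fst (inv_into ?D s (t c))" for c
  have r_eq: "r c = fst d" if "c \<in> ?D" "d \<in> ?D" "t c = s d" for c d
    unfolding r_def using that si by simp
  have ex: "\<exists>d\<in>?D. t c = s d" if "c \<in> ?D" for c
    using that tim sim by (metis imageE imageI)
  define Dj where "Dj j = {c \<in> ?D. snd c = j}" for j
  have fD: "finite (Dj j)" for j using finite_diagram by (simp add: Dj_def)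
  have r_inj: "inj_on r (Dj j)" for j
  proof (rule inj_onI)
    fix c c' assume c: "c \<in> Dj j" "c' \<in> Dj j" "r c = r c'"
    then obtain d d' where "d \<in> ?D" "t c = s d" "d' \<in> ?D" "t c' = s d'"
      using ex[of c] ex[of c'] by (auto simp: Dj_def)
    then show "c = c'" using distinct[of c c' d d'] r_eq[of c d] r_eq[of c' d'] c by (simp add: Dj_def)
  qed
  have fst_inj: "inj_on fst (Dj j)" for j by (auto simp: inj_on_def Dj_def)
  have fstD: "fst ` Dj j = {..<card (Dj j)}" for j
  proof -
    have "fst ` Dj j = {i. (i, j) \<in> ?D}" by (force simp: Dj_def)
    then show ?thesis
      using column_eq_lessThan[OF lam, of j] card_image[OF fst_inj, of j] by simp
  qed
  have card_r: "card (r ` Dj j) = card (Dj j)" for j using r_inj by (rule card_image)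
  \<comment> \<open>Both totals run over the entries \<open>1..n\<close> and add up the row of
    \<open>s\<close> in which each entry stands.\<close>
  have "(\<Sum>c\<in>?D. fst c) = (\<Sum>x\<in>{1..n}. fst (inv_into ?D s x))"
    unfolding sim[symmetric] by (subst sum.reindex[OF si]) (use si in simp)
  also have "\<dots> = (\<Sum>c\<in>?D. r c)"
    unfolding tim[symmetric] by (subst sum.reindex[OF ti]) (simp add: r_def)
  finally have "(\<Sum>j\<in>snd ` ?D. \<Sum>c\<in>Dj j. fst c) = (\<Sum>j\<in>snd ` ?D. \<Sum>c\<in>Dj j. r c)"
    unfolding Dj_def by (simp add: sum.image_gen[OF finite_diagram, symmetric])
  moreover have "(\<Sum>c\<in>Dj j. r c) = \<Sum>(r ` Dj j)" "(\<Sum>c\<in>Dj j. fst c) = \<Sum>{..<card (r ` Dj j)}" for j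
    using sum.reindex[OF r_inj, of "\<lambda>x. x" j] sum.reindex[OF fst_inj, of "\<lambda>x. x" j]
    by (simp_all add: fstD card_r)
  ultimately have "(\<Sum>j\<in>snd ` ?D. \<Sum>{..<card (r ` Dj j)}) = (\<Sum>j\<in>snd ` ?D. \<Sum>(r ` Dj j))" by simp
  \<comment> \<open>A termwise inequality with equal totals is an equality in every term.\<close>
  then have "\<Sum>{..<card (r ` Dj j)} = \<Sum>(r ` Dj j)" if "j \<in> snd ` ?D" for j
    by (rule sum_mono_inv) (use that sum_lessThan_card_le(1) fD finite_diagram in auto)
  then have rD: "r ` Dj j = fst ` Dj j" if "j \<in> snd ` ?D" for j
    using sum_lessThan_card_le(2)[of "r ` Dj j"] that fD by (simp add: fstD card_r)
  \<comment> \<open>\<open>\<phi>\<close> keeps a cell in its column and moves it to the row that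
    its entry has in \<open>s\<close>. Conjugated by \<open>t\<close> it becomes the required column
    permutation \<open>p\<close>.\<close>
  define \<phi> where "\<phi> c = (r c, snd c)" for c
  have \<phi>D: "\<phi> c \<in> Dj (snd c)" if "c \<in> ?D" for c
  proof -
    have "r c \<in> fst ` Dj (snd c)" using rD[of "snd c"] that by (auto simp: Dj_def)
    then show ?thesis by (auto simp: \<phi>_def Dj_def)
  qed
  have \<phi>i: "inj_on \<phi> ?D"
    using r_inj by (auto simp: inj_on_def \<phi>_def Dj_def)
  have \<phi>Dj: "\<phi> ` Dj j = Dj j" for j
    using \<phi>D by (intro endo_inj_surj fD inj_on_subset[OF \<phi>i]) (auto simp: Dj_def)
  have "\<phi> ` ?D \<subseteq> ?D" using \<phi>D by (auto simp: Dj_def)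
  then have \<phi>b: "bij_betw \<phi> ?D ?D"
    using \<phi>i endo_inj_surj[OF finite_diagram _ \<phi>i] by (simp add: bij_betw_def)
  define p where "p x = (if x \<in> {1..n} then t (\<phi> (inv_into ?D t x)) else x)" for x
  have pt: "p (t c) = t (\<phi> c)" if "c \<in> ?D" for c
    using that ti tim by (auto simp: p_def)
  have "bij_betw (t \<circ> \<phi> \<circ> inv_into ?D t) {1..n} {1..n}"
    using t \<phi>b unfolding is_tableau_def by (meson bij_betw_inv_into bij_betw_trans)
  then have "bij_betw p {1..n} {1..n}"
    by (rule bij_betw_cong[THEN iffD1, rotated]) (simp add: p_def)
  then have perm: "p permutes {1..n}"
    by (rule bij_imp_permutes) (auto simp: p_def)
  have "p ` A = A" if A_col: "A \<in> columns lam t" for A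
  proof -
    obtain j where A: "A = t ` Dj j" using A_col by (auto simp: columns_def Dj_def)
    have "p ` t ` Dj j = t ` \<phi> ` Dj j"
      unfolding image_image by (rule image_cong) (auto simp: pt Dj_def)
    then show ?thesis by (simp add: A \<phi>Dj)
  qed
  then have "p \<in> young_subgroup n (columns lam t)" using perm by (simp add: young_subgroup_iff)
  moreover have "tabloid lam (p \<circ> s) = tabloid lam t"
    unfolding tabloid_eq_iff
  proof (intro allI impI)
    fix i
    let ?E = "{c \<in> ?D. fst c = i}"
    have fE: "finite ?E" using finite_diagram by simp
    have "p (s c) \<in> t ` ?E" if c: "c \<in> ?E" for c
    proof -
      obtain c' where c': "c' \<in> ?D" "t c' = s c"
          using c tim sim by (metis (lifting) imageE imageI mem_Collect_eq)
      then have "p (s c) = t (\<phi> c')" using pt by metis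
      moreover have "fst (\<phi> c') = i" using r_eq[of c' c] c c' by (simp add: \<phi>_def)
      moreover have "\<phi> c' \<in> ?D" using \<phi>D[OF c'(1)] by (simp add: Dj_def)
      ultimately show ?thesis by blast
    qed
    then have "(p \<circ> s) ` ?E \<subseteq> t ` ?E" by auto
    moreover have "card ((p \<circ> s) ` ?E) = card (t ` ?E)"
    proof -
      have "inj_on s ?E" "inj_on t ?E" using si ti by (auto intro: inj_on_subset)
      moreover have "inj_on p (s ` ?E)" using permutes_inj[OF perm] by (rule inj_on_subset) simp
      ultimately show ?thesis by (simp only: card_image comp_inj_on)
    qed
    ultimately show "(p \<circ> s) ` ?E = t ` ?E" using fE by (simp add: card_subset_eq)
  qed
  ultimately show ?thesis by blast
qed

text \<open>If two entries share a column of \<open>t\<close> and a row of \<open>s\<close>, their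
  transposition lies in the column group and fixes the tabloid of \<open>s\<close>, so the value
  there equals its own negative. Otherwise a column permutation carries the tabloid of
  \<open>s\<close> to that of \<open>t\<close>, and the two values agree up to sign.\<close>

lemma alternating_eq_0:
  assumes lam: "is_partition n lam" and t: "is_tableau n lam t" and s: "is_tableau n lam s"
    and alt: "\<And>g. g \<in> young_subgroup n (columns lam t) \<Longrightarrow> tact g f = tscale (of_int (sign g)) f"
    and "f (tabloid lam t) = 0"
  shows "f (tabloid lam s) = 0"
proof (cases "\<exists>c\<in>diagram lam. \<exists>c'\<in>diagram lam. \<exists>d\<in>diagram lam. \<exists>d'\<in>diagram lam.
    snd c = snd c' \<and> t c = s d \<and> t c' = s d' \<and> fst d = fst d' \<and> c \<noteq> c'")
  case True
  then obtain c c' d d' where D: "c \<in> diagram lam" "c' \<in> diagram lam" "d \<in> diagram lam" "d' \<in> diagram lam"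
    and eq: "snd c = snd c'" "t c = s d" "t c' = s d'" "fst d = fst d'" and ne: "c \<noteq> c'"
    by blast
  note ti = tableau_inj[OF t] and tim = tableau_image[OF t]
  note si = tableau_inj[OF s]
  let ?g = "Transposition.transpose (t c) (t c')"
  have "?g permutes {1..n}" using D tim by (intro permutes_swap_id) auto
  moreover have "?g ` A = A" if "A \<in> columns lam t" for A
  proof (rule transpose_image_eq)
    obtain j where "A = t ` {b \<in> diagram lam. snd b = j}"
      using \<open>A \<in> columns lam t\<close> by (auto simp: columns_def)
    then show "t c \<in> A \<longleftrightarrow> t c' \<in> A"
      using mem_image_class_iff[OF ti D(1), of snd j] mem_image_class_iff[OF ti D(2), of snd j] eq(1)
      by simp
  qed
  ultimately have g: "?g \<in> young_subgroup n (columns lam t)" by (simp add: young_subgroup_iff)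
  have "?g ` s ` {b \<in> diagram lam. fst b = i} = s ` {b \<in> diagram lam. fst b = i}" for i
    using mem_image_class_iff[OF si D(3), of fst i] mem_image_class_iff[OF si D(4), of fst i] eq
    by (intro transpose_image_eq) simp
  then have "map ((`) ?g) (tabloid lam s) = tabloid lam s" by (simp add: tabloid_def)
  then have "tact ?g f (tabloid lam s) = f (tabloid lam s)" by (simp add: tact_def)
  moreover have "sign ?g = -1" using ti ne D by (auto simp: sign_swap_id dest: inj_onD)
  ultimately have "f (tabloid lam s) = - f (tabloid lam s)"
    by (simp add: alt[OF g] tscale_def)
  then show ?thesis by simp
next
  case False
  then obtain p where p: "p \<in> young_subgroup n (columns lam t)"
    and eq: "tabloid lam (p \<circ> s) = tabloid lam t"
    using exists_column_permutation[OF lam t s] by meson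
  \<comment> \<open>\<open>tact\<close> acts through the inverse, so it is \<open>inv' p\<close>
    whose action reads \<open>f\<close> at the tabloid of \<open>p \<circ> s\<close>.\<close>
  have "inv' (inv' p) = p" using p by (metis inv_inv_eq permutes_bij young_subgroup_iff)
  then have "tact (inv' p) f (tabloid lam s) = f (tabloid lam t)"
    by (simp add: tact_def tabloid_comp flip: eq)
  then show ?thesis
    using assms(5) by (simp add: alt[OF young_subgroup_inv[OF p]] tscale_def)
qed

section \<open>Polytabloids as alternating vectors\<close>

lemma polytabloid_apply:
  "polytabloid n lam t D = (\<Sum>\<sigma>\<in>young_subgroup n (columns lam t).
     of_int (sign \<sigma>) * (if D = tabloid lam (\<sigma> \<circ> t) then 1 else 0))"
proof -
  have "(\<Sum>x\<in>A. f x) D = (\<Sum>x\<in>A. f x D)" for A and f :: "(nat \<Rightarrow> nat) \<Rightarrow> nat set list \<Rightarrow> complex"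
    by (induction A rule: infinite_finite_induct) simp_all
  then show ?thesis by (simp only: polytabloid_def tscale_def)
qed

text \<open>A permutation that preserves every row and every column of \<open>t\<close> fixes each
  entry, so only the identity contributes. In particular polytabloids are nonzero.\<close>

lemma polytabloid_tabloid:
  assumes t: "is_tableau n lam t"
  shows "polytabloid n lam t (tabloid lam t) = 1"
proof -
  let ?C = "young_subgroup n (columns lam t)"
  note ti = tableau_inj[OF t] and tim = tableau_image[OF t]
  have "\<sigma> = id" if \<sigma>: "\<sigma> \<in> ?C" and eq: "tabloid lam t = tabloid lam (\<sigma> \<circ> t)" for \<sigma>
  proof
    fix x
    show "\<sigma> x = id x"
    proof (cases "x \<in> {1..n}")
      case True
      then obtain c where c: "c \<in> diagram lam" "x = t c" using tim by (metis imageE)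
      have "t ` {d \<in> diagram lam. snd d = snd c} \<in> columns lam t"
        using c by (auto simp: columns_def)
      then have "\<sigma> ` t ` {d \<in> diagram lam. snd d = snd c} = t ` {d \<in> diagram lam. snd d = snd c}"
        using \<sigma> by (simp add: young_subgroup_iff)
      then have "\<sigma> x \<in> t ` {d \<in> diagram lam. snd d = snd c}" using c by auto
      then obtain d where d: "d \<in> diagram lam" "snd d = snd c" "\<sigma> x = t d" by auto
      have "fst c < length lam" using c by (auto simp: diagram_def)
      then have "(\<sigma> \<circ> t) ` {d \<in> diagram lam. fst d = fst c} = t ` {d \<in> diagram lam. fst d = fst c}"
        using eq[symmetric] by (simp only: tabloid_eq_iff)
      then have "\<sigma> x \<in> t ` {d \<in> diagram lam. fst d = fst c}" using c by auto
      then have "fst d = fst c" using d mem_image_class_iff[OF ti d(1), of fst] by simp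
      then have "d = c" using d(2) by (simp add: prod_eq_iff)
      then show ?thesis using d c by simp
    next
      case False
      then show ?thesis using \<sigma> permutes_not_in by (fastforce simp: young_subgroup_iff)
    qed
  qed
  then have *: "tabloid lam t = tabloid lam (\<sigma> \<circ> t) \<longleftrightarrow> \<sigma> = id" if "\<sigma> \<in> ?C" for \<sigma> using that by auto
  have "polytabloid n lam t (tabloid lam t)
      = (\<Sum>\<sigma>\<in>?C. of_int (sign \<sigma>) * (if tabloid lam t = tabloid lam (\<sigma> \<circ> t) then 1 else 0))"
    by (rule polytabloid_apply)
  also have "\<dots> = (\<Sum>\<sigma>\<in>?C. if \<sigma> = id then 1 else 0)"
    by (rule sum.cong) (use * in auto)
  finally show ?thesis using finite_young_subgroup young_subgroup_id by simp
qed

lemma polytabloid_eq_alternator: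
  "polytabloid n lam t
     = alternator n tscale tact (columns lam t) (\<lambda>D. if D = tabloid lam t then 1 else 0)"
  unfolding polytabloid_def alternator_def
  by (rule sum.cong[OF refl], subst tact_tabloid_basis[of _ n]) (simp_all add: young_subgroup_iff)

lemma tact_comp:
  assumes "bij \<sigma>" "bij \<tau>"
  shows "tact (\<sigma> \<circ> \<tau>) f = tact \<sigma> (tact \<tau> f)"
  using o_inv_distrib[OF assms] by (simp add: tact_def comp_def image_comp)

text \<open>A polytabloid is the alternator of the basis vector at a tabloid. That vector need not
  lie in the Specht module, so the facts on alternators are applied to the space of all
  functions.\<close>

lemma sym_rep_tact: "sym_rep n tscale UNIV tact"
proof -
  interpret vector_space tscale by (rule vector_space_tscale)
  show ?thesis
  proof
    fix \<sigma> \<tau> and v :: "nat set list \<Rightarrow> complex"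
    assume "\<sigma> \<in> carrier (sym_group n)" "\<tau> \<in> carrier (sym_group n)"
    then show "tact (\<sigma> \<otimes>\<^bsub>sym_group n\<^esub> \<tau>) v = tact \<sigma> (tact \<tau> v)"
      using tact_comp[of \<sigma> \<tau>] by (simp add: sym_group_def permutes_bij)
  qed (auto simp: linear_on_def tact_def tscale_def sym_group_def)
qed

lemma tact_polytabloid_column:
  assumes "g \<in> young_subgroup n (columns lam t)"
  shows "tact g (polytabloid n lam t) = tscale (of_int (sign g)) (polytabloid n lam t)"
  unfolding polytabloid_eq_alternator
  by (rule sym_rep.rep_alternator[OF sym_rep_tact assms]) simp

lemma polytabloid_support:
  assumes t: "is_tableau n lam t" and D: "\<And>s. is_tableau n lam s \<Longrightarrow> D \<noteq> tabloid lam s"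
  shows "polytabloid n lam t D = 0"
proof -
  have "is_tableau n lam (\<sigma> \<circ> t)" if "\<sigma> \<in> young_subgroup n (columns lam t)" for \<sigma>
    using t that permutes_imp_bij unfolding is_tableau_def young_subgroup_iff by (meson bij_betw_trans)
  then have "D \<noteq> tabloid lam (\<sigma> \<circ> t)" if "\<sigma> \<in> young_subgroup n (columns lam t)" for \<sigma>
    using that D by blast
  then show ?thesis by (simp add: polytabloid_apply)
qed

text \<open>\<open>alternating_eq_0\<close> speaks only of tabloids of tableaux; this settles the
  coefficients at all other lists of sets.\<close>

lemma specht_support:
  assumes f: "f \<in> specht n lam" and D: "\<And>s. is_tableau n lam s \<Longrightarrow> D \<noteq> tabloid lam s"
  shows "f D = 0"
proof -
  interpret vector_space tscale by (rule vector_space_tscale)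
  show ?thesis
    using f unfolding specht_def
  proof (induction rule: span_induct_alt)
    case (step c x y)
    then show ?case using polytabloid_support[OF _ D] by (auto simp: tscale_def)
  qed simp
qed

lemma polytabloid_in_specht:
  assumes "is_tableau n lam t"
  shows "polytabloid n lam t \<in> specht n lam"
proof -
  interpret vector_space tscale by (rule vector_space_tscale)
  show ?thesis unfolding specht_def using assms by (intro span_base) blast
qed

lemma alternator_specht:
  assumes lam: "is_partition n lam" and t: "is_tableau n lam t" and f: "f \<in> specht n lam"
  shows "\<exists>c. alternator n tscale tact (columns lam t) f = tscale c (polytabloid n lam t)"
proof -
  interpret S: sym_rep n tscale "specht n lam" tact by (rule sym_rep_specht)
  let ?a = "alternator n tscale tact (columns lam t) f"
  \<comment> \<open>The polytabloid has coefficient 1 at the tabloid of \<open>t\<close>, so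
    subtracting \<open>?c\<close> times it makes the coefficient of \<open>h\<close> there
    vanish.\<close>
  let ?c = "?a (tabloid lam t)"
  define h where "h = ?a - tscale ?c (polytabloid n lam t)"
  have hS: "h \<in> specht n lam"
    unfolding h_def
    by (intro S.subspace_diff S.subspace_V S.subspace_scale S.alternator_closed f
        polytabloid_in_specht t)
  have h_alt: "tact g h = tscale (of_int (sign g)) h"
    if g: "g \<in> young_subgroup n (columns lam t)" for g
  proof -
    have "tact g h = tact g ?a - tact g (tscale ?c (polytabloid n lam t))"
      by (simp add: h_def tact_def fun_eq_iff)
    also have "\<dots> = tscale (of_int (sign g)) ?a
        - tscale ?c (tscale (of_int (sign g)) (polytabloid n lam t))"
      by (simp only: S.rep_alternator[OF g f] tact_linear tact_polytabloid_column[OF g])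
    also have "\<dots> = tscale (of_int (sign g)) h"
      by (simp add: h_def tscale_def fun_eq_iff right_diff_distrib mult.left_commute)
    finally show ?thesis .
  qed
  have h0: "h (tabloid lam t) = 0" by (simp add: h_def tscale_def polytabloid_tabloid[OF t])
  have "h D = 0" for D
    using alternating_eq_0[OF lam t _ h_alt h0] specht_support[OF hS] by metis
  then have "h = 0" by auto
  then show ?thesis by (auto simp: h_def)
qed

text \<open>A tableau is a function on all pairs, with arbitrary values off the diagram, but its
  polytabloid depends only on the restriction to the diagram, and there are finitely many
  restrictions.\<close>

lemma specht_finitely_spanned:
  "\<exists>F. finite F \<and> F \<subseteq> specht n lam \<and> specht n lam = module.span tscale F"
proof -
  interpret vector_space tscale by (rule vector_space_tscale)
  let ?F = "{polytabloid n lam t | t. is_tableau n lam t}"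
  have "?F \<subseteq> polytabloid n lam ` (diagram lam \<rightarrow>\<^sub>E {1..n})"
  proof clarify
    fix t assume t: "is_tableau n lam t"
    let ?r = "restrict t (diagram lam)"
    have "columns lam ?r = columns lam t"
      unfolding columns_def by (intro image_cong refl) auto
    moreover have "tabloid lam (\<sigma> \<circ> ?r) = tabloid lam (\<sigma> \<circ> t)" for \<sigma>
      unfolding tabloid_eq_iff by (intro allI impI image_cong refl) auto
    ultimately have "polytabloid n lam t = polytabloid n lam ?r"
      unfolding polytabloid_def by simp
    moreover have "?r \<in> diagram lam \<rightarrow>\<^sub>E {1..n}"
      using tableau_image[OF t] by auto
    ultimately show "polytabloid n lam t \<in> polytabloid n lam ` (diagram lam \<rightarrow>\<^sub>E {1..n})" by blast
  qed
  then have "finite ?F"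
    by (rule finite_subset) (intro finite_imageI finite_PiE finite_diagram finite_atLeastAtMost)
  moreover have "?F \<subseteq> specht n lam" using polytabloid_in_specht by blast
  ultimately show ?thesis unfolding specht_def by blast
qed

section \<open>Tableaux with prescribed columns\<close>

text \<open>List the blocks so that their sizes match the column lengths, and fill each column with
  its block in any order.\<close>

lemma exists_tableau_columns:
  assumes lam: "is_partition n lam" and \<alpha>: "partition_on {1..n} \<alpha>"
    and type: "partition_type \<alpha> = conj_partition lam"
  shows "\<exists>t. is_tableau n lam t \<and> columns lam t = \<alpha>"
proof -
  define m where "m = fold max lam 0"
  define k where "k j = card {i. (i, j) \<in> diagram lam}" for j
  have k: "(i, j) \<in> diagram lam \<longleftrightarrow> i < k j" for i j
    using column_eq_lessThan[OF lam, of j] unfolding k_def by auto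
  have m: "j < m" if "(i, j) \<in> diagram lam" for i j
  proof -
    have "m = Max (set (0 # lam))" unfolding m_def by (rule Max.set_eq_fold[symmetric])
    then have "lam ! i \<le> m" using that by (auto simp: diagram_def)
    then show ?thesis using that by (auto simp: diagram_def)
  qed
  have fin: "finite \<alpha>" using finite_elements[OF _ \<alpha>] by simp
  have blocks: "finite A" "A \<noteq> {}" if "A \<in> \<alpha>" for A
  proof -
    have "A \<subseteq> {1..n}" using that partition_onD1[OF \<alpha>] by blast
    then show "finite A" by (rule finite_subset) simp
    show "A \<noteq> {}" using that partition_onD3[OF \<alpha>] by blast
  qed
  obtain xs where xs: "set xs = \<alpha>" "distinct xs" using finite_distinct_list[OF fin] by blast
  have "mset_set \<alpha> = mset xs" using xs by (metis mset_set_set)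
  then have "mset (conj_partition lam) = mset (map card xs)"
    unfolding type[symmetric] partition_type_def by simp
  \<comment> \<open>Equal multisets of sizes give a reordering of the blocks in which the block at
    position \<open>j\<close> has the length of column \<open>j\<close>.\<close>
  then obtain p where p: "p permutes {..<length (map card xs)}"
    "permute_list p (map card xs) = conj_partition lam"
    by (rule mset_eq_permutation)
  define As where "As = permute_list p xs"
  have p': "p permutes {..<length xs}" using p by simp
  have As: "set As = \<alpha>" "distinct As" "map card As = map k [0..<m]"
    using xs p by (simp_all add: As_def set_permute_list[OF p'] distinct_permute_list[OF p']
        permute_list_map[OF p', symmetric] conj_partition_def m_def k_def)
  have len: "length As = m" using arg_cong[OF As(3), of length] by simp
  have cardA: "card (As ! j) = k j" if "j < m" for j
    using arg_cong[OF As(3), of "\<lambda>xs. xs ! j"] that len by simp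
  have A_in: "As ! j \<in> \<alpha>" if "j < m" for j using As(1) len that nth_mem by blast
  have "\<exists>h. bij_betw h {..<k j} (As ! j)" if "j < m" for j
    using ex_bij_betw_nat_finite[OF blocks(1)[OF A_in[OF that]]] cardA[OF that]
    by (simp add: lessThan_atLeast0)
  then obtain h where h: "\<And>j. j < m \<Longrightarrow> bij_betw (h j) {..<k j} (As ! j)" by metis
  define t where "t c = h (snd c) (fst c)" for c
  have t_in: "t c \<in> As ! snd c" if "c \<in> diagram lam" for c
    using that h[OF m] k by (cases c) (auto simp: t_def dest: bij_betwE)
  have col: "t ` {c \<in> diagram lam. snd c = j} = As ! j" if "j < m" for j
  proof -
    have "{c \<in> diagram lam. snd c = j} = (\<lambda>i. (i, j)) ` {..<k j}" using k by auto
    then show ?thesis using h[OF that] by (simp add: image_image t_def bij_betw_def)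
  qed
  \<comment> \<open>Blocks are nonempty, so each \<open>j < m\<close> is the index of an actual
    column and every block occurs in \<open>columns\<close>.\<close>
  have snd: "snd ` diagram lam = {..<m}"
  proof (intro equalityI subsetI)
    fix j assume "j \<in> {..<m}"
    then have "0 < k j" using cardA[of j] blocks[OF A_in[of j]] by (metis card_gt_0_iff lessThan_iff)
    then have "(0, j) \<in> diagram lam" using k by simp
    then show "j \<in> snd ` diagram lam" by force
  qed (use m in auto)
  have nths: "(!) As ` {..<m} = \<alpha>" using As(1) len by (auto simp: set_conv_nth)
  have "columns lam t = \<alpha>"
    unfolding columns_def snd nths[symmetric] by (rule image_cong) (use col in auto)
  moreover have "bij_betw t (diagram lam) {1..n}"
  proof (rule bij_betw_imageI)
    show "inj_on t (diagram lam)"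
    proof (rule inj_onI)
      fix c c' assume c: "c \<in> diagram lam" "c' \<in> diagram lam" "t c = t c'"
      have lt: "snd c < m" "snd c' < m" using c m by (metis prod.collapse)+
      have "As ! snd c = As ! snd c'"
        using partition_onD2[OF \<alpha>] A_in[OF lt(1)] A_in[OF lt(2)] t_in[OF c(1)] t_in[OF c(2)] c(3)
        by (auto simp: disjoint_def)
      then have eq: "snd c = snd c'" using As(2) lt len by (simp add: nth_eq_iff_index_eq)
      moreover have "fst c = fst c'"
        using bij_betw_imp_inj_on[OF h[OF lt(1)]] c eq k
        by (metis inj_onD lessThan_iff prod.collapse t_def)
      ultimately show "c = c'" by (simp add: prod_eq_iff)
    qed
    have "t ` diagram lam = (\<Union>j\<in>snd ` diagram lam. t ` {c \<in> diagram lam. snd c = j})" by auto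
    also have "\<dots> = \<Union>\<alpha>" unfolding snd nths[symmetric] using col by auto
    finally show "t ` diagram lam = {1..n}" using partition_onD1[OF \<alpha>] by simp
  qed
  ultimately show ?thesis unfolding is_tableau_def by blast
qed

subsection \<open>Codimension\<close>

text \<open>Adjoining \<open>e\<close> to a basis of \<open>H\<close> gives a basis of
  \<open>V\<close>. The finite set \<open>F\<close> keeps these bases finite, as \<open>card\<close>
  of an infinite one would be 0.\<close>

lemma (in vector_space) dim_eq_Suc_dim_hyperplane:
  assumes H: "subspace H" "H \<subseteq> V" and V: "subspace V" "V \<subseteq> span F" "finite F"
    and e: "e \<in> V" "e \<notin> H" and decomp: "\<And>v. v \<in> V \<Longrightarrow> \<exists>c. v - c *s e \<in> H"
  shows "dim V = dim H + 1"
proof -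
  obtain B where B: "B \<subseteq> H" "independent B" "H \<subseteq> span B" by (meson maximal_independent_subset)
  have sB: "span B = H" using B H(1) by (simp add: span_subspace)
  have "B \<subseteq> span F" using B H V by blast
  then have fB: "finite B" using independent_span_bound[OF V(3) B(2)] by blast
  have "dim H = card B" by (rule dim_unique[OF B(1) B(3) B(2) refl])
  moreover have "dim V = card (insert e B)"
  proof (rule dim_unique[OF _ _ _ refl])
    show "insert e B \<subseteq> V" using B H e by blast
    show "independent (insert e B)" using B(2) e(2) sB by (simp add: independent_insertI)
    show "V \<subseteq> span (insert e B)"
    proof
      fix v assume "v \<in> V"
      then obtain c where "v - c *s e \<in> span B" using decomp sB by blast
      then show "v \<in> span (insert e B)" using span_breakdown_eq by blast
    qed
  qed
  moreover have "e \<notin> B" using B(1) e(2) by blast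
  ultimately show ?thesis using fB by simp
qed

section \<open>Transport along isomorphisms of representations\<close>

lemma linear_on_inverse:
  assumes f: "linear_on s s' V f" and "bij_betw f V W" and V: "module.subspace s V" "module s"
  shows "linear_on s' s W (inv_into V f)"
proof -
  interpret module s by fact
  have W: "f ` V = W" and inj: "inj_on f V" using assms(2) by (auto simp: bij_betw_def)
  have inv: "inv_into V f (f v) = v" if "v \<in> V" for v using inj that by simp
  show ?thesis
    unfolding linear_on_def W[symmetric]
  proof (intro conjI ballI allI)
    fix x y assume "x \<in> f ` V" "y \<in> f ` V"
    then obtain v w where vw: "v \<in> V" "w \<in> V" "x = f v" "y = f w" by blast
    then have "x + y = f (v + w)" using f by (simp add: linear_on_def)
    then show "inv_into V f (x + y) = inv_into V f x + inv_into V f y"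
      using vw inv subspace_add[OF V(1)] by simp
  next
    fix c x assume "x \<in> f ` V"
    then obtain v where v: "v \<in> V" "x = f v" by blast
    then have "s' c x = f (s c v)" using f by (simp add: linear_on_def)
    then show "inv_into V f (s' c x) = s c (inv_into V f x)"
      using v inv subspace_scale[OF V(1)] by simp
  qed
qed

lemma linear_on_image_span:
  assumes "linear_on s s' (module.span s F) f" "module s" "module s'"
  shows "f ` module.span s F \<subseteq> module.span s' (f ` F)"
proof -
  interpret M: module s by fact
  interpret N: module s' by fact
  \<comment> \<open>Membership in the span is carried through the induction because \<open>f\<close>
    is known to be linear only there.\<close>
  have "v \<in> M.span F \<and> f v \<in> N.span (f ` F)" if "v \<in> M.span F" for v
    using that
  proof (induction rule: M.span_induct_alt)
    case base
    then show ?case using linear_on_0[OF assms(1) M.span_zero] M.span_zero N.span_zero by simp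
  next
    case (step c x y)
    then have "f (s c x + y) = s' c (f x) + f y"
      using assms(1) by (simp add: linear_on_def M.span_base M.span_scale)
    then show ?case using step
      by (simp add: M.span_add M.span_scale M.span_base N.span_add N.span_scale N.span_base)
  qed
  then show ?thesis by blast
qed

text \<open>An intertwining linear map commutes with each summand; this brings the rank-one
  computation from the Specht module to \<open>V\<close>.\<close>

lemma rep_iso_alternator:
  assumes iso: "rep_iso n s V \<rho> s' W \<rho>' f" and rep: "sym_rep n s V \<rho>" and v: "v \<in> V"
  shows "f (alternator n s \<rho> \<alpha> v) = alternator n s' \<rho>' \<alpha> (f v)"
proof -
  interpret sym_rep n s V \<rho> by fact
  have lin: "linear_on s s' V f" using iso by (simp add: rep_iso_def)
  have "f (alternator n s \<rho> \<alpha> v)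
      = (\<Sum>g\<in>young_subgroup n \<alpha>. f (s (of_int (sign g)) (\<rho> g v)))"
    unfolding alternator_def
    by (rule linear_on_sum[OF lin subspace_V module_axioms])
      (intro subspace_scale subspace_V young_rep_closed v)
  also have "\<dots> = (\<Sum>g\<in>young_subgroup n \<alpha>. s' (of_int (sign g)) (\<rho>' g (f v)))"
  proof (rule sum.cong[OF refl])
    fix g assume g: "g \<in> young_subgroup n \<alpha>"
    then have "f (s (of_int (sign g)) (\<rho> g v)) = s' (of_int (sign g)) (f (\<rho> g v))"
      using lin young_rep_closed[OF g v] by (simp add: linear_on_def)
    also have "f (\<rho> g v) = \<rho>' g (f v)"
      using iso g v by (simp add: rep_iso_def young_subgroup_def)
    finally show "f (s (of_int (sign g)) (\<rho> g v)) = s' (of_int (sign g)) (\<rho>' g (f v))" .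
  qed
  finally show ?thesis by (simp add: alternator_def)
qed

section \<open>Codimension one in any copy of the irreducible representation\<close>

theorem lemma3:
  fixes n :: nat and lam :: "nat list" and \<alpha> :: "nat set set"
    and scale :: "complex \<Rightarrow> 'v::ab_group_add \<Rightarrow> 'v" and V :: "'v set"
    and \<rho> :: "(nat \<Rightarrow> nat) \<Rightarrow> 'v \<Rightarrow> 'v" and T :: "(nat \<Rightarrow> nat) set"
  assumes "is_partition n lam"
    and "irrep_with_diagram n lam scale V \<rho>"
    and "partition_on {1..n} \<alpha>" and "partition_type \<alpha> = conj_partition lam"
    and "T \<subseteq> transpositions n" and "generate (sym_group n) T = young_subgroup n \<alpha>"
  shows "(\<forall>T'. T' \<subseteq> transpositions n \<and> generate (sym_group n) T' = young_subgroup n \<alpha>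
            \<longrightarrow> fixed_sum V \<rho> T' = fixed_sum V \<rho> T)
       \<and> module.subspace scale (fixed_sum V \<rho> T) \<and> fixed_sum V \<rho> T \<subseteq> V
       \<and> vector_space.dim scale V = vector_space.dim scale (fixed_sum V \<rho> T) + 1"
proof -
  interpret sym_rep n scale V \<rho> using assms(2) by (simp add: irrep_with_diagram_def)
  interpret S: sym_rep n tscale "specht n lam" tact by (rule sym_rep_specht)
  obtain f where iso: "rep_iso n scale V \<rho> tscale (specht n lam) tact f"
    using assms(2) by (auto simp: irrep_with_diagram_def)
  then have bij: "bij_betw f V (specht n lam)" and lin: "linear_on scale tscale V f"
    by (simp_all add: rep_iso_def)
  have inj: "inj_on f V" and im: "f ` V = specht n lam" using bij by (simp_all add: bij_betw_def)
  obtain t where t: "is_tableau n lam t" and cols: "columns lam t = \<alpha>"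
    using exists_tableau_columns[OF assms(1,3,4)] by blast
  let ?A = "alternator n scale \<rho> \<alpha>" and ?N = "of_nat (card (young_subgroup n \<alpha>)) :: complex"
  \<comment> \<open>This kernel does not mention \<open>T\<close>, so identifying every
    \<open>fixed_sum\<close> with it gives the independence of the generating set.\<close>
  define H where "H = {v \<in> V. ?A v = 0}"
  have H_eq: "fixed_sum V \<rho> T' = H"
    if "T' \<subseteq> transpositions n" "generate (sym_group n) T' = young_subgroup n \<alpha>" for T'
    unfolding H_def using that by (rule fixed_sum_eq_kernel)
  have "T \<subseteq> young_subgroup n \<alpha>"
    unfolding assms(6)[symmetric] by (rule subsetI, rule generate.incl)
  then have subH: "subspace H" using subspace_fixed_sum H_eq[OF assms(5,6)] by metis
  have N0: "?N \<noteq> 0"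
    using young_subgroup_id finite_young_subgroup by (metis card_eq_0_iff empty_iff of_nat_eq_0_iff)
  \<comment> \<open>\<open>e\<close> corresponds to the polytabloid of \<open>t\<close>; it spans
    the image of \<open>?A\<close> and will be the complement of \<open>H\<close>.\<close>
  obtain e where e: "e \<in> V" "f e = polytabloid n lam t"
    using im polytabloid_in_specht[OF t] by (metis imageE)
  have fe0: "f e \<noteq> 0" using polytabloid_tabloid[OF t] e(2) by auto
  have e0: "e \<noteq> 0" using fe0 linear_on_0[OF lin subspace_0[OF subspace_V]] by blast
  have A_range: "\<exists>c. ?A v = scale c e" if v: "v \<in> V" for v
  proof -
    have "f v \<in> specht n lam" using v im by blast
    from alternator_specht[OF assms(1) t this] obtain c where
      "alternator n tscale tact \<alpha> (f v) = tscale c (f e)" unfolding cols e(2) by blast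
    then have "f (?A v) = f (scale c e)"
      using rep_iso_alternator[OF iso sym_rep_axioms v] lin e(1) by (simp add: linear_on_def)
    then show ?thesis
      using inj_onD[OF inj _ alternator_closed[OF v] subspace_scale[OF subspace_V e(1)]] by blast
  qed
  have decomp: "scale ?N v - ?A v \<in> H" if "v \<in> V" for v
    using card_scale_minus_alternator[OF assms(5,6) that] H_eq[OF assms(5,6)] by simp
  have eH: "e \<notin> H"
  proof
    assume "e \<in> H"
    \<comment> \<open>The group acts on \<open>e\<close> by the sign, so every summand of
      \<open>?A e\<close> is \<open>e\<close> itself and \<open>?A e\<close> is \<open>?N\<close>
      times \<open>e\<close>.\<close>
    have "\<rho> g e = scale (of_int (sign g)) e" if g: "g \<in> young_subgroup n \<alpha>" for g
    proof (rule inj_onD[OF inj _ young_rep_closed[OF g e(1)] subspace_scale[OF subspace_V e(1)]])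
      have "f (\<rho> g e) = tact g (f e)" using iso g e(1) by (simp add: rep_iso_def young_subgroup_def)
      also have "\<dots> = tscale (of_int (sign g)) (f e)"
        using tact_polytabloid_column[of g n lam t] g by (simp add: cols e(2))
      finally show "f (\<rho> g e) = f (scale (of_int (sign g)) e)"
        using lin e(1) by (simp add: linear_on_def)
    qed
    then have "?A e = (\<Sum>g\<in>young_subgroup n \<alpha>. e)"
      unfolding alternator_def by (intro sum.cong refl) (simp add: sign_times_sign)
    then have "scale ?N e = 0" using \<open>e \<in> H\<close> by (simp add: H_def sum_constant_scale)
    then show False using N0 e0 by simp
  qed
  have hyper: "\<exists>c. v - scale c e \<in> H" if v: "v \<in> V" for v
  proof -
    obtain c where "?A v = scale c e" using A_range[OF v] by blast
    \<comment> \<open>Dividing \<open>?N v - ?A v\<close> by \<open>?N\<close> shows that the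
      coefficient of \<open>e\<close> to be removed from \<open>v\<close> is
      \<open>c / ?N\<close>.\<close>
    then have "scale (inverse ?N) (scale ?N v - scale c e) \<in> H"
      using subspace_scale[OF subH decomp[OF v]] by simp
    then have "v - scale (inverse ?N * c) e \<in> H" using N0 by (simp add: scale_right_diff_distrib)
    then show ?thesis by blast
  qed
  obtain F where F: "finite F" "specht n lam = S.span F"
    using specht_finitely_spanned by blast
  \<comment> \<open>The inverse isomorphism pulls a finite spanning set of the Specht module back to
    \<open>V\<close>.\<close>
  let ?g = "inv_into V f"
  have "?g ` specht n lam \<subseteq> span (?g ` F)"
    using linear_on_image_span[of tscale scale F ?g]
      linear_on_inverse[OF lin bij subspace_V module_axioms] F(2) S.module_axioms module_axioms
    by simp
  then have "V \<subseteq> span (?g ` F)"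
    using bij_betw_inv_into[OF bij] by (simp add: bij_betw_def)
  then have "dim V = dim H + 1"
    using F(1) e(1) subH subspace_V eH hyper
    by (intro dim_eq_Suc_dim_hyperplane[of H V "?g ` F" e]) (auto simp: H_def)
  then show ?thesis using H_eq subH H_eq[OF assms(5,6)] by (auto simp: H_def)
qed

end
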